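(* Let $I=[t_0,\infty)$, let $\omega\in\mathbb{R}$ be a constant, and let $\alpha:I\to\mathbb{R}$ be a differentiable function. Consider the equation $$\ddot{x}+\alpha(t)\dot{x}-\omega^2x=0,\qquad t\in I,$$ and write $\mathbf{x}=(x,\dot{x})$. Suppose that for all $t\ge t_0$: (1) $\alpha(t)>0$, (2) $\dot{\alpha}(t)>0$, (3) $\dfrac{d}{dt}\ln\alpha(t)>\dfrac{1}{2}\left[\dfrac{1}{\alpha(t)}+\omega^2\right]^2$. Then the solutions of the equation are bounded for every initial condition $\mathbf{x}_0=\mathbf{x}(t_0)\in\mathbb{R}^2$.
   Context: A dot denotes differentiation with respect to the independent variable $t\in I=[t_0,\infty)$. The scalar equation is identified with the planar system $\dot{x}_1=x_2$, $\dot{x}_2=\omega^2x_1-\alpha(t)x_2$ for $\mathbf{x}=(x_1,x_2)=(x,\dot{x})\in\mathbb{R}^2$, with initial condition $\mathbf{x}_0=\mathbf{x}(t_0)$. The Euclidean norm $\|\cdot\|$ on $\mathbb{R}^2$ is used; a solution is bounded if $\sup_{t\ge t_0}\|\mathbf{x}(t)\|<\infty$. It is assumed throughout that the coefficients are such that solutions exist and are unique for all initial conditions $\mathbf{x}_0\in\mathbb{R}^2$ and all initial times $t_0$. *)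

theory Defs
  imports "HOL-Analysis.Analysis"
begin

text \<open>
  The function \<open>x\<close>, with derivative \<open>v\<close>, satisfies
  \<open>x'' + \<alpha>(t) x' - \<omega>\<^sup>2 x = 0\<close> on \<open>[s, \<infinity>)\<close>; the state of the equivalent planar system is
  \<open>(x t, v t)\<close>. Derivatives are taken within \<open>{s..}\<close>, hence are one-sided at \<open>s\<close>,
  and nothing is required of \<open>x\<close>, \<open>v\<close> and \<open>\<alpha>\<close> to the left of \<open>s\<close>.
\<close>

definition solution_from ::
    "real \<Rightarrow> (real \<Rightarrow> real) \<Rightarrow> real \<Rightarrow> (real \<Rightarrow> real) \<Rightarrow> (real \<Rightarrow> real) \<Rightarrow> bool" where
  "solution_from \<omega> \<alpha> s x v \<longleftrightarrow>
     (\<forall>t\<ge>s. (x has_real_derivative v t) (at t within {s..}) \<and>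
       (\<exists>a. (v has_real_derivative a) (at t within {s..}) \<and>
            a + \<alpha> t * v t - \<omega>\<^sup>2 * x t = 0))"

text \<open>
  Standing assumption: for every initial time \<open>s \<in> [t\<^sub>0, \<infinity>)\<close> and every initial state there is
  a solution on \<open>[s, \<infinity>)\<close>, and its values there are determined by the initial state.
\<close>

definition uniquely_solvable :: "real \<Rightarrow> (real \<Rightarrow> real) \<Rightarrow> real \<Rightarrow> bool" where
  "uniquely_solvable \<omega> \<alpha> t\<^sub>0 \<longleftrightarrow>
     (\<forall>s\<ge>t\<^sub>0. \<forall>x\<^sub>0 :: real \<times> real.
        (\<exists>x v. solution_from \<omega> \<alpha> s x v \<and> (x s, v s) = x\<^sub>0) \<and>
        (\<forall>x v y w. solution_from \<omega> \<alpha> s x v \<and> (x s, v s) = x\<^sub>0 \<and>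
                   solution_from \<omega> \<alpha> s y w \<and> (y s, w s) = x\<^sub>0 \<longrightarrow>
                   (\<forall>t\<ge>s. (x t, v t) = (y t, w t))))"

end

theory Submission
  imports Defs
begin

text \<open>
  The damping grows, and where \<open>\<omega> \<noteq> 0\<close> it grows exponentially: the lower bound on \<open>(ln \<alpha>)'\<close>
  gives \<open>\<alpha>' / \<alpha> \<ge> \<omega>\<^sup>4 / 2\<close>. A solution is therefore slaved to \<open>v \<approx> \<omega>\<^sup>2 x / \<alpha>\<close>, which makes the
  relative growth rate of \<open>x\<close> integrable. To turn this into a proof, differentiate
  \<open>x\<^sup>2 + v\<^sup>2\<close> along a solution and complete the square in \<open>v\<close>: its logarithmic derivative is at most
  \<open>(1 + \<omega>\<^sup>2)\<^sup>2 / (2 \<alpha>)\<close>. Exponential growth of \<open>\<alpha>\<close>, in the form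
  \<open>1 / \<alpha> \<le> - (2 / \<omega>\<^sup>4) (1 / \<alpha>)'\<close>, bounds this rate by the derivative of the bounded function
  \<open>- K / \<alpha>\<close> with \<open>K = (1 + \<omega>\<^sup>2)\<^sup>2 / \<omega>\<^sup>4\<close>. So \<open>(x\<^sup>2 + v\<^sup>2) exp (K / \<alpha>)\<close> is a Lyapunov function, and
  it dominates \<open>x\<^sup>2 + v\<^sup>2\<close>.

  For \<open>\<omega> = 0\<close> that bound only forces growth of order \<open>\<surd>t\<close>, so that \<open>1 / \<alpha>\<close> need not be
  integrable, and the argument above breaks down. Here \<open>v' = - \<alpha> v\<close>, so \<open>v\<^sup>2\<close> does not increase, while
  \<open>x + v / \<alpha>\<close> has derivative \<open>- v \<alpha>' / \<alpha>\<^sup>2 = v (1 / \<alpha>)'\<close>. As \<open>v\<close> is bounded and \<open>1 / \<alpha>\<close> is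
  decreasing and positive, \<open>x + v / \<alpha>\<close> has bounded variation, which bounds \<open>x\<close>.
\<close>

lemma nonpos_deriv_imp_le_initial:
  fixes f f' :: "real \<Rightarrow> real"
  assumes "\<And>t. t \<ge> a \<Longrightarrow> (f has_real_derivative f' t) (at t within {a..})"
    and "\<And>t. t \<ge> a \<Longrightarrow> f' t \<le> 0"
    and "a \<le> t"
  shows "f t \<le> f a"
proof (rule DERIV_nonpos_imp_decreasing_open[OF \<open>a \<le> t\<close>])
  fix s assume "a < s" "s < t"
  then have "at s within {a..} = at s"
    by (intro at_within_interior) simp
  then show "\<exists>y. (f has_real_derivative y) (at s) \<and> y \<le> 0"
    using assms(1,2)[of s] \<open>a < s\<close> by auto
next
  have "continuous_on {a..} f"
    using assms(1) by (intro DERIV_continuous_on) auto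
  then show "continuous_on {a..t} f"
    by (rule continuous_on_subset) auto
qed

lemma solution_from_derivatives:
  assumes "solution_from \<omega> \<alpha> s x v" "t \<ge> s"
  shows "(x has_real_derivative v t) (at t within {s..})"
    and "(v has_real_derivative \<omega>\<^sup>2 * x t - \<alpha> t * v t) (at t within {s..})"
proof -
  obtain a where "(x has_real_derivative v t) (at t within {s..})"
    and "(v has_real_derivative a) (at t within {s..})" and "a + \<alpha> t * v t - \<omega>\<^sup>2 * x t = 0"
    using assms unfolding solution_from_def by blast
  moreover from this(3) have "a = \<omega>\<^sup>2 * x t - \<alpha> t * v t" by simp
  ultimately show "(x has_real_derivative v t) (at t within {s..})"
    and "(v has_real_derivative \<omega>\<^sup>2 * x t - \<alpha> t * v t) (at t within {s..})" by simp_all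
qed

text \<open>
  The damping term \<open>- 2 a v\<^sup>2\<close> absorbs the mixed term: the left-hand side, which is the derivative of
  \<open>x\<^sup>2 + v\<^sup>2\<close> along a solution, falls short of \<open>(1 + \<omega>\<^sup>2)\<^sup>2 x\<^sup>2 / (2 a)\<close> by a positive multiple
  of the square of \<open>2 a v - (1 + \<omega>\<^sup>2) x\<close>.
\<close>

lemma damping_absorbs_mixed_term:
  fixes x v a \<omega> :: real
  assumes "a > 0"
  shows "2 * x * v + 2 * v * (\<omega>\<^sup>2 * x - a * v) \<le> (1 + \<omega>\<^sup>2)\<^sup>2 / (2 * a) * (x\<^sup>2 + v\<^sup>2)"
proof -
  have "0 \<le> (2 * a * v - (1 + \<omega>\<^sup>2) * x)\<^sup>2 / (2 * a)"
    using assms by simp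
  also have "\<dots> = (1 + \<omega>\<^sup>2)\<^sup>2 / (2 * a) * x\<^sup>2 - (2 * x * v + 2 * v * (\<omega>\<^sup>2 * x - a * v))"
    using assms by (simp add: field_simps power2_eq_square)
  finally have "2 * x * v + 2 * v * (\<omega>\<^sup>2 * x - a * v) \<le> (1 + \<omega>\<^sup>2)\<^sup>2 / (2 * a) * x\<^sup>2"
    by simp
  also have "\<dots> \<le> (1 + \<omega>\<^sup>2)\<^sup>2 / (2 * a) * (x\<^sup>2 + v\<^sup>2)"
    using assms by (intro mult_left_mono) auto
  finally show ?thesis .
qed

text \<open>
  Exponentially growing damping: with \<open>K = (1 + \<omega>\<^sup>2)\<^sup>2 / (2 c)\<close>, the weight
  \<open>exp (K / \<alpha>)\<close> stays between 1 and its initial value, and its decay compensates the possible growth of \<open>x\<^sup>2 + v\<^sup>2\<close>.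
\<close>

lemma energy_bound_exponential_damping:
  fixes \<alpha> \<alpha>' x v :: "real \<Rightarrow> real"
  assumes sol: "solution_from \<omega> \<alpha> t\<^sub>0 x v"
    and deriv: "\<And>t. t \<ge> t\<^sub>0 \<Longrightarrow> (\<alpha> has_real_derivative \<alpha>' t) (at t within {t\<^sub>0..})"
    and pos: "\<And>t. t \<ge> t\<^sub>0 \<Longrightarrow> \<alpha> t > 0"
    and growth: "\<And>t. t \<ge> t\<^sub>0 \<Longrightarrow> \<alpha>' t / \<alpha> t \<ge> c"
    and "c > 0" and "t \<ge> t\<^sub>0"
  shows "(x t)\<^sup>2 + (v t)\<^sup>2
    \<le> ((x t\<^sub>0)\<^sup>2 + (v t\<^sub>0)\<^sup>2) * exp ((1 + \<omega>\<^sup>2)\<^sup>2 / (2 * c) / \<alpha> t\<^sub>0)"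
proof -
  define K where "K = (1 + \<omega>\<^sup>2)\<^sup>2 / (2 * c)"
  have "K \<ge> 0" using \<open>c > 0\<close> by (simp add: K_def)
  define E where "E = (\<lambda>t. (x t)\<^sup>2 + (v t)\<^sup>2)"
  define E' where "E' = (\<lambda>t. 2 * x t * v t + 2 * v t * (\<omega>\<^sup>2 * x t - \<alpha> t * v t))"
  define G' where "G' = (\<lambda>t. (E' t - E t * (K * \<alpha>' t / (\<alpha> t)\<^sup>2)) * exp (K / \<alpha> t))"
  have "E t * exp (K / \<alpha> t) \<le> E t\<^sub>0 * exp (K / \<alpha> t\<^sub>0)"
  proof (rule nonpos_deriv_imp_le_initial[where f' = G', OF _ _ \<open>t \<ge> t\<^sub>0\<close>])
    fix s assume s: "s \<ge> t\<^sub>0"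
    note [derivative_intros] = solution_from_derivatives[OF sol s] deriv[OF s]
    show "((\<lambda>t. E t * exp (K / \<alpha> t)) has_real_derivative G' s) (at s within {t\<^sub>0..})"
      unfolding E_def G'_def E'_def using pos[OF s]
      by (auto intro!: derivative_eq_intros simp: field_simps power2_eq_square)
    have "E' s \<le> (1 + \<omega>\<^sup>2)\<^sup>2 / (2 * \<alpha> s) * E s"
      unfolding E'_def E_def by (rule damping_absorbs_mixed_term[OF pos[OF s]])
    also have "\<dots> = E s * (K * c / \<alpha> s)"
      using \<open>c > 0\<close> by (simp add: K_def)
    also have "\<dots> \<le> E s * (K * (\<alpha>' s / \<alpha> s) / \<alpha> s)"
      using growth[OF s] pos[OF s] \<open>K \<ge> 0\<close>
      by (intro mult_left_mono divide_right_mono) (auto simp: E_def)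
    also have "\<dots> = E s * (K * \<alpha>' s / (\<alpha> s)\<^sup>2)"
      by (simp add: power2_eq_square)
    finally show "G' s \<le> 0"
      unfolding G'_def by (intro mult_nonpos_nonneg) auto
  qed
  moreover have "E t * 1 \<le> E t * exp (K / \<alpha> t)"
    using pos[OF \<open>t \<ge> t\<^sub>0\<close>] \<open>K \<ge> 0\<close> by (intro mult_left_mono) (auto simp: E_def)
  ultimately show ?thesis
    unfolding E_def K_def by simp
qed

text \<open>
  The speed never exceeds \<open>C = \<bar>v t\<^sub>0\<bar>\<close>, since \<open>(v\<^sup>2)' = - 2 \<alpha> v\<^sup>2 \<le> 0\<close>. Hence
  \<open>x + v / \<alpha> + C / \<alpha>\<close> and \<open>- (x + v / \<alpha>) + C / \<alpha>\<close> are both non-increasing: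
  \<open>x + v / \<alpha>\<close> varies no faster than \<open>C / \<alpha>\<close>.
\<close>

lemma bounds_undriven_damping:
  fixes \<alpha> \<alpha>' x v :: "real \<Rightarrow> real"
  assumes sol: "solution_from 0 \<alpha> t\<^sub>0 x v"
    and deriv: "\<And>t. t \<ge> t\<^sub>0 \<Longrightarrow> (\<alpha> has_real_derivative \<alpha>' t) (at t within {t\<^sub>0..})"
    and pos: "\<And>t. t \<ge> t\<^sub>0 \<Longrightarrow> \<alpha> t > 0"
    and mono: "\<And>t. t \<ge> t\<^sub>0 \<Longrightarrow> \<alpha>' t \<ge> 0"
    and t: "t \<ge> t\<^sub>0"
  shows "\<bar>v t\<bar> \<le> \<bar>v t\<^sub>0\<bar>"
    and "\<bar>x t\<bar> \<le> \<bar>x t\<^sub>0 + v t\<^sub>0 / \<alpha> t\<^sub>0\<bar> + \<bar>v t\<^sub>0\<bar> / \<alpha> t\<^sub>0"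
proof -
  define C where "C = \<bar>v t\<^sub>0\<bar>"
  have v_le: "\<bar>v s\<bar> \<le> C" if "s \<ge> t\<^sub>0" for s
  proof -
    have "(v s)\<^sup>2 \<le> (v t\<^sub>0)\<^sup>2"
    proof (rule nonpos_deriv_imp_le_initial[where f' = "\<lambda>r. - 2 * \<alpha> r * (v r)\<^sup>2", OF _ _ that])
      fix r assume r: "r \<ge> t\<^sub>0"
      show "((\<lambda>r. (v r)\<^sup>2) has_real_derivative - 2 * \<alpha> r * (v r)\<^sup>2) (at r within {t\<^sub>0..})"
        using solution_from_derivatives(2)[OF sol r]
        by (auto intro!: derivative_eq_intros simp: power2_eq_square)
      show "- 2 * \<alpha> r * (v r)\<^sup>2 \<le> 0"
        using pos[OF r] by simp
    qed
    then show ?thesis by (simp add: C_def abs_le_square_iff)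
  qed
  then show "\<bar>v t\<bar> \<le> \<bar>v t\<^sub>0\<bar>" using t by (simp add: C_def)
  define u where "u = (\<lambda>t. x t + v t / \<alpha> t)"
  have signed_bound: "\<sigma> * u t + C / \<alpha> t \<le> \<sigma> * u t\<^sub>0 + C / \<alpha> t\<^sub>0" if \<sigma>: "\<bar>\<sigma>\<bar> = 1" for \<sigma> :: real
  proof (rule nonpos_deriv_imp_le_initial[where
        f' = "\<lambda>s. - (C + \<sigma> * v s) * (\<alpha>' s / (\<alpha> s)\<^sup>2)", OF _ _ t])
    fix s assume s: "s \<ge> t\<^sub>0"
    note [derivative_intros] = solution_from_derivatives[OF sol s] deriv[OF s]
    show "((\<lambda>s. \<sigma> * u s + C / \<alpha> s) has_real_derivative - (C + \<sigma> * v s) * (\<alpha>' s / (\<alpha> s)\<^sup>2))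
        (at s within {t\<^sub>0..})"
      unfolding u_def using pos[OF s]
      by (auto intro!: derivative_eq_intros simp: field_simps power2_eq_square)
    have "\<bar>\<sigma> * v s\<bar> \<le> C" using v_le[OF s] \<sigma> by (simp add: abs_mult)
    then have "- (C + \<sigma> * v s) \<le> 0" by linarith
    then show "- (C + \<sigma> * v s) * (\<alpha>' s / (\<alpha> s)\<^sup>2) \<le> 0"
      using mono[OF s] by (intro mult_nonpos_nonneg) auto
  qed
  have "\<bar>u t\<bar> + C / \<alpha> t \<le> \<bar>u t\<^sub>0\<bar> + C / \<alpha> t\<^sub>0"
    using signed_bound[of 1] signed_bound[of "-1"] by (simp add: abs_if)
  moreover have "\<bar>v t / \<alpha> t\<bar> \<le> C / \<alpha> t"
    using v_le[OF t] pos[OF t] by (simp add: divide_right_mono)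
  moreover have "\<bar>x t\<bar> \<le> \<bar>u t\<bar> + \<bar>v t / \<alpha> t\<bar>"
    unfolding u_def by linarith
  ultimately show "\<bar>x t\<bar> \<le> \<bar>x t\<^sub>0 + v t\<^sub>0 / \<alpha> t\<^sub>0\<bar> + \<bar>v t\<^sub>0\<bar> / \<alpha> t\<^sub>0"
    unfolding u_def C_def by linarith
qed

theorem theorem2p2:
  fixes \<omega> t\<^sub>0 :: real and \<alpha> \<alpha>' L' :: "real \<Rightarrow> real"
  assumes "uniquely_solvable \<omega> \<alpha> t\<^sub>0"
    and "\<And>t. t \<ge> t\<^sub>0 \<Longrightarrow> (\<alpha> has_real_derivative \<alpha>' t) (at t within {t\<^sub>0..})"
    and "\<And>t. t \<ge> t\<^sub>0 \<Longrightarrow> \<alpha> t > 0"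
    and "\<And>t. t \<ge> t\<^sub>0 \<Longrightarrow> \<alpha>' t > 0"
    and "\<And>t. t \<ge> t\<^sub>0 \<Longrightarrow> ((\<lambda>s. ln (\<alpha> s)) has_real_derivative L' t) (at t within {t\<^sub>0..})"
    and "\<And>t. t \<ge> t\<^sub>0 \<Longrightarrow> L' t > 1 / 2 * (1 / \<alpha> t + \<omega>\<^sup>2)\<^sup>2"
  shows "\<forall>x\<^sub>0 :: real \<times> real. \<forall>x v. solution_from \<omega> \<alpha> t\<^sub>0 x v \<and> (x t\<^sub>0, v t\<^sub>0) = x\<^sub>0 \<longrightarrow>
           bounded ((\<lambda>t. (x t, v t)) ` {t\<^sub>0..})"
proof (intro allI impI)
  fix x\<^sub>0 :: "real \<times> real" and x v :: "real \<Rightarrow> real"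
  assume "solution_from \<omega> \<alpha> t\<^sub>0 x v \<and> (x t\<^sub>0, v t\<^sub>0) = x\<^sub>0"
  then have sol: "solution_from \<omega> \<alpha> t\<^sub>0 x v" by simp
  note deriv = assms(2) and pos = assms(3) and incr = assms(4)
  show "bounded ((\<lambda>t. (x t, v t)) ` {t\<^sub>0..})"
  proof (cases "\<omega> = 0")
    case True
    with sol have sol0: "solution_from 0 \<alpha> t\<^sub>0 x v" by simp
    note bounds = bounds_undriven_damping[of \<alpha> t\<^sub>0 x v \<alpha>', OF sol0 deriv pos less_imp_le[OF incr]]
    have "norm (x t, v t) \<le> \<bar>x t\<^sub>0 + v t\<^sub>0 / \<alpha> t\<^sub>0\<bar> + \<bar>v t\<^sub>0\<bar> / \<alpha> t\<^sub>0 + \<bar>v t\<^sub>0\<bar>"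
      if "t \<ge> t\<^sub>0" for t
      using norm_Pair_le[of "x t" "v t"] bounds[OF _ _ _ that] by simp
    then show ?thesis by (auto simp: bounded_iff)
  next
    case False
    define c where "c = \<omega> ^ 4 / 2"
    have "c > 0" using False by (simp add: c_def)
    have growth: "\<alpha>' t / \<alpha> t \<ge> c" if t: "t \<ge> t\<^sub>0" for t
    proof -
      have "((\<lambda>s. ln (\<alpha> s)) has_real_derivative \<alpha>' t / \<alpha> t) (at t within {t\<^sub>0..})"
        using deriv[OF t] pos[OF t] by (auto intro!: derivative_eq_intros simp: field_simps)
      moreover have "at t within {t\<^sub>0..} \<noteq> bot"
      proof -
        have "at_right t \<le> at t within {t\<^sub>0..}"
          using t by (intro at_le) auto
        then show ?thesis
          using trivial_limit_at_right_real[of t] by (auto simp: bot_unique)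
      qed
      ultimately have "L' t = \<alpha>' t / \<alpha> t"
        using assms(5)[OF t] has_field_derivative_unique by blast
      moreover have "(\<omega>\<^sup>2)\<^sup>2 \<le> (1 / \<alpha> t + \<omega>\<^sup>2)\<^sup>2"
        using pos[OF t] by (intro power_mono) auto
      ultimately show ?thesis
        using assms(6)[OF t] by (simp add: c_def)
    qed
    define M where
      "M = ((x t\<^sub>0)\<^sup>2 + (v t\<^sub>0)\<^sup>2) * exp ((1 + \<omega>\<^sup>2)\<^sup>2 / (2 * c) / \<alpha> t\<^sub>0)"
    have "norm (x t, v t) \<le> sqrt M" if "t \<ge> t\<^sub>0" for t
      using energy_bound_exponential_damping[OF sol deriv pos growth \<open>c > 0\<close> that]
      by (simp add: norm_Pair M_def)
    then show ?thesis by (auto simp: bounded_iff)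
  qed
qed

end
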